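(* Let $\kappa\in\mathbb{R}$ and $\rho_0>0$, and consider the class of compact spaces $X$ with curvature $\leq\kappa$ and convexity radius $\rho(X)\ge\rho_0$. Then any family of spaces in this class that is precompact with respect to the Gromov–Hausdorff distance contains only finitely many homotopy types.
   Context: **Complete length spaces.** For a metric space $(X,d)$ the length of a continuous path $\gamma:[a,b]\to X$ is $L(\gamma)=\sup\sum_i d(\gamma(t_i),\gamma(t_{i+1}))$ over all partitions. $(X,d)$ is a length space if $d(x_1,x_2)$ is the infimum of lengths of paths joining $x_1,x_2$ for all $x_1,x_2$; it is a complete length space (geodesic space) if moreover any two points are joined by a shortest path, i.e. a path of length $d(x_1,x_2)$. **Convexity radius.** A subset $A$ of a length space is convex if any two points of $A$ are joined by a unique shortest path and this path lies in $A$. The convexity radius is $\rho(X)=\inf_{x\in X}\sup\{r\ge 0\mid \mathbb{B}_X(x,s)\text{ is convex for all }0<s<r\}$, where $\mathbb{B}_X(x,s)$ is the open metric ball. **Curvature $\leq\kappa$.** A complete length space $(X,d)$ has curvature $\leq\kappa$ if for any $x_1,x_2,x_3$ in a convex ball of $X$ (and, if $\kappa>0$, with $d(x_1,x_2)+d(x_2,x_3)+d(x_3,x_1)<2\pi/\sqrt{\kappa}$) and any $y$ on a shortest path joining $x_1$ and $x_3$, we have $d(y,x_2)\le d(\overline y,\overline x_2)$, where $\overline x_1,\overline x_2,\overline x_3$ are points of the model surface of constant curvature $\kappa$ with $d(\overline x_i,\overline x_j)=d(x_i,x_j)$ and $\overline y$ is the point on the shortest path joining $\overline x_1$ and $\overline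 x_3$ with $d(\overline x_1,\overline y)=d(x_1,y)$. **Precompactness.** A family of compact metric spaces is precompact if its set of isometry classes is relatively compact (equivalently, totally bounded) in the space of isometry classes of compact metric spaces with the Gromov–Hausdorff distance. *)

theory Defs
  imports "HOL-Analysis.Analysis"
begin

section \<open>Complete length spaces\<close>

text \<open>Paths are taken on the unit interval. A subdivision of it is a finite nondecreasing
  sequence \<open>t 0, \<dots>, t n\<close> with \<open>t 0 = 0\<close> and \<open>t n = 1\<close>.\<close>

definition path_length :: "'a metric \<Rightarrow> (real \<Rightarrow> 'a) \<Rightarrow> ereal" where
  "path_length X g =
     Sup {ereal (\<Sum>i<n. mdist X (g (t i)) (g (t (Suc i)))) | n t.
            mono_on {..n} t \<and> t 0 = 0 \<and> t n = (1::real)}"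

definition joins :: "'a metric \<Rightarrow> 'a \<Rightarrow> 'a \<Rightarrow> (real \<Rightarrow> 'a) \<Rightarrow> bool" where
  "joins X x y g \<longleftrightarrow> pathin (mtopology_of X) g \<and> g 0 = x \<and> g 1 = y"

definition shortest_path :: "'a metric \<Rightarrow> 'a \<Rightarrow> 'a \<Rightarrow> (real \<Rightarrow> 'a) \<Rightarrow> bool" where
  "shortest_path X x y g \<longleftrightarrow> joins X x y g \<and> path_length X g = ereal (mdist X x y)"

definition length_space :: "'a metric \<Rightarrow> bool" where
  "length_space X \<longleftrightarrow>
     (\<forall>x\<in>mspace X. \<forall>y\<in>mspace X. ereal (mdist X x y) = (INF g\<in>{g. joins X x y g}. path_length X g))"

definition complete_length_space :: "'a metric \<Rightarrow> bool" where
  "complete_length_space X \<longleftrightarrow>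
     length_space X \<and> (\<forall>x\<in>mspace X. \<forall>y\<in>mspace X. \<exists>g. shortest_path X x y g)"

section \<open>Convexity radius\<close>

text \<open>Uniqueness of a shortest path is meant up to reparametrization: two paths are identified
  if they become equal after composition with nondecreasing continuous surjections of the unit
  interval.\<close>

definition reparametrization :: "(real \<Rightarrow> real) \<Rightarrow> bool" where
  "reparametrization \<phi> \<longleftrightarrow>
     continuous_on {0..1} \<phi> \<and> mono_on {0..1} \<phi> \<and> \<phi> 0 = 0 \<and> \<phi> 1 = 1"

definition same_path :: "(real \<Rightarrow> 'a) \<Rightarrow> (real \<Rightarrow> 'a) \<Rightarrow> bool" where
  "same_path g h \<longleftrightarrow>
     (\<exists>\<phi> \<psi>. reparametrization \<phi> \<and> reparametrization \<psi> \<and> (\<forall>t\<in>{0..1}. g (\<phi> t) = h (\<psi> t)))"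

definition convex_in :: "'a metric \<Rightarrow> 'a set \<Rightarrow> bool" where
  "convex_in X A \<longleftrightarrow> A \<subseteq> mspace X \<and>
     (\<forall>x\<in>A. \<forall>y\<in>A. \<exists>g. shortest_path X x y g \<and> g ` {0..1} \<subseteq> A \<and>
        (\<forall>h. shortest_path X x y h \<longrightarrow> same_path g h))"

definition convexity_radius :: "'a metric \<Rightarrow> ereal" where
  "convexity_radius X =
     (INF x\<in>mspace X. SUP r\<in>{r. 0 \<le> r \<and> (\<forall>s. 0 < s \<and> s < r \<longrightarrow> convex_in X (mball_of X x s))}. ereal r)"

section \<open>Model surfaces of constant curvature\<close>

text \<open>All three models are realized inside \<open>real^3\<close>: the unit sphere with the angular metric
  divided by \<open>sqrt \<kappa>\<close>, a Euclidean plane, and the upper sheet of the unit hyperboloid with the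
  hyperbolic metric divided by \<open>sqrt (-\<kappa>)\<close>.\<close>

definition sphere_dist :: "real^3 \<Rightarrow> real^3 \<Rightarrow> real" where
  "sphere_dist u v = arccos (u \<bullet> v)"

definition lorentz :: "real^3 \<Rightarrow> real^3 \<Rightarrow> real" where
  "lorentz u v = u$1 * v$1 + u$2 * v$2 - u$3 * v$3"

definition hyperboloid :: "(real^3) set" where
  "hyperboloid = {u. lorentz u u = -1 \<and> u$3 > 0}"

definition hyp_dist :: "real^3 \<Rightarrow> real^3 \<Rightarrow> real" where
  "hyp_dist u v = arcosh (- lorentz u v)"

text \<open>The library demands a nonnegative distance function even off the carrier, hence the value 0
  there.\<close>

definition metric_on :: "'a set \<Rightarrow> ('a \<Rightarrow> 'a \<Rightarrow> real) \<Rightarrow> 'a metric" where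
  "metric_on S d = metric (S, \<lambda>x y. if x \<in> S \<and> y \<in> S then d x y else 0)"

definition model_surface :: "real \<Rightarrow> (real^3) metric" where
  "model_surface \<kappa> =
     (if \<kappa> > 0 then metric_on (sphere 0 1) (\<lambda>u v. sphere_dist u v / sqrt \<kappa>)
      else if \<kappa> = 0 then metric_on {u. u$3 = 0} dist
      else metric_on hyperboloid (\<lambda>u v. hyp_dist u v / sqrt (- \<kappa>)))"

text \<open>The constructor \<open>metric\<close> is only meaningful on pairs satisfying the metric axioms, which
  are verified here.\<close>

lemma sphere_dist_triangle:
  fixes u v w :: "real^3"
  assumes "norm u = 1" "norm v = 1" "norm w = 1"
  shows "sphere_dist u w \<le> sphere_dist u v + sphere_dist v w"
proof -
  have bd: "\<bar>a \<bullet> b\<bar> \<le> 1" if "norm a = 1" "norm b = 1" for a b :: "real^3"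
    using Cauchy_Schwarz_ineq2[of a b] that by simp
  define a where "a = u \<bullet> v"
  define b where "b = v \<bullet> w"
  have ab: "\<bar>a\<bar> \<le> 1" "\<bar>b\<bar> \<le> 1" "\<bar>u \<bullet> w\<bar> \<le> 1"
    using bd assms by (auto simp: a_def b_def)
  have nn: "u \<bullet> u = 1" "v \<bullet> v = 1" "w \<bullet> w = 1"
    using assms by (auto simp: dot_square_norm)
  have n1: "norm (u - a *\<^sub>R v) = sqrt (1 - a\<^sup>2)"
    unfolding norm_eq_sqrt_inner
    by (rule arg_cong[where f = sqrt])
       (simp add: inner_diff_left inner_diff_right nn inner_commute a_def power2_eq_square algebra_simps)
  have n2: "norm (w - b *\<^sub>R v) = sqrt (1 - b\<^sup>2)"
    unfolding norm_eq_sqrt_inner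
    by (rule arg_cong[where f = sqrt])
       (simp add: inner_diff_left inner_diff_right nn inner_commute b_def power2_eq_square algebra_simps)
  have ip: "(u - a *\<^sub>R v) \<bullet> (w - b *\<^sub>R v) = u \<bullet> w - a * b"
    by (simp add: inner_diff_left inner_diff_right nn inner_commute a_def b_def algebra_simps)
  have "\<bar>u \<bullet> w - a * b\<bar> \<le> sqrt (1 - a\<^sup>2) * sqrt (1 - b\<^sup>2)"
    using Cauchy_Schwarz_ineq2[of "u - a *\<^sub>R v" "w - b *\<^sub>R v"] unfolding ip n1 n2 .
  then have key: "a * b - sqrt (1 - a\<^sup>2) * sqrt (1 - b\<^sup>2) \<le> u \<bullet> w"
    by linarith
  have A: "0 \<le> arccos a" "arccos a \<le> pi" "0 \<le> arccos b" "arccos b \<le> pi"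
    using ab by (auto intro: arccos_lbound arccos_ubound)
  show ?thesis
  proof (cases "arccos a + arccos b \<le> pi")
    case True
    have "cos (arccos a + arccos b) = a * b - sqrt (1 - a\<^sup>2) * sqrt (1 - b\<^sup>2)"
      using ab by (simp add: cos_add sin_arccos abs_le_iff)
    then have "cos (arccos a + arccos b) \<le> cos (arccos (u \<bullet> w))"
      using key ab by (simp add: abs_le_iff)
    then have "arccos (u \<bullet> w) \<le> arccos a + arccos b"
      using True A ab by (subst (asm) cos_mono_le_eq) (auto intro: arccos_lbound arccos_ubound)
    then show ?thesis by (simp add: sphere_dist_def a_def b_def)
  next
    case False
    have "arccos (u \<bullet> w) \<le> pi" using ab by (intro arccos_ubound) auto
    then show ?thesis using False by (simp add: sphere_dist_def a_def b_def)
  qed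
qed

lemma sphere_dist_eq_0:
  fixes u v :: "real^3"
  assumes "norm u = 1" "norm v = 1"
  shows "sphere_dist u v = 0 \<longleftrightarrow> u = v"
proof
  assume "sphere_dist u v = 0"
  moreover have "\<bar>u \<bullet> v\<bar> \<le> 1" using Cauchy_Schwarz_ineq2[of u v] assms by simp
  ultimately have "u \<bullet> v = 1"
    by (metis abs_le_iff cos_arccos cos_zero minus_le_iff sphere_dist_def)
  then have "u \<bullet> v = norm u * norm v" using assms by simp
  then show "u = v" using assms norm_cauchy_schwarz_eq[of u v] by simp
next
  assume "u = v"
  then show "sphere_dist u v = 0" using assms by (simp add: sphere_dist_def dot_square_norm)
qed

lemma Metric_space_sphere:
  assumes "c > 0"
  shows "Metric_space (sphere 0 1) (\<lambda>u v. if u \<in> sphere 0 1 \<and> v \<in> sphere 0 1 then sphere_dist u v / c else 0)"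
proof -
  have "0 \<le> sphere_dist u v" if "norm u = 1" "norm v = 1" for u v
    using Cauchy_Schwarz_ineq2[of u v] that unfolding sphere_dist_def
    by (intro arccos_lbound) auto
  then show ?thesis
    using assms
    by unfold_locales
      (auto simp: sphere_dist_eq_0 divide_right_mono sphere_dist_triangle
            simp flip: add_divide_distrib, auto simp: sphere_dist_def inner_commute)
qed

lemma lorentz_commute: "lorentz u v = lorentz v u"
  by (simp add: lorentz_def algebra_simps)

lemma lorentz_le:
  assumes "u \<in> hyperboloid" "v \<in> hyperboloid"
  shows "lorentz u v \<le> -1" "lorentz u v = -1 \<Longrightarrow> u = v"
proof -
  have u: "(u$3)\<^sup>2 = 1 + (u$1)\<^sup>2 + (u$2)\<^sup>2" "u$3 > 0"
   and v: "(v$3)\<^sup>2 = 1 + (v$1)\<^sup>2 + (v$2)\<^sup>2" "v$3 > 0"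
    using assms by (auto simp: hyperboloid_def lorentz_def power2_eq_square)
  define s where "s = 1 + u$1 * v$1 + u$2 * v$2"
  have "(u$3 * v$3)\<^sup>2 = (1 + (u$1)\<^sup>2 + (u$2)\<^sup>2) * (1 + (v$1)\<^sup>2 + (v$2)\<^sup>2)"
    by (simp add: power_mult_distrib u v)
  then have eq: "(u$3 * v$3)\<^sup>2 = s\<^sup>2 + (u$1 - v$1)\<^sup>2 + (u$2 - v$2)\<^sup>2 + (u$1 * v$2 - u$2 * v$1)\<^sup>2"
    by (simp add: s_def power2_eq_square algebra_simps)
  then have "s\<^sup>2 \<le> (u$3 * v$3)\<^sup>2" by simp
  then have "s \<le> u$3 * v$3"
    using u(2) v(2) by (meson less_imp_le mult_nonneg_nonneg power2_le_imp_le)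
  then show "lorentz u v \<le> -1" by (simp add: s_def lorentz_def)
  assume "lorentz u v = -1"
  then have "u$3 * v$3 = s" by (simp add: s_def lorentz_def)
  with eq have "(u$1 - v$1)\<^sup>2 + (u$2 - v$2)\<^sup>2 + (u$1 * v$2 - u$2 * v$1)\<^sup>2 = 0" by simp
  then have 12: "u$1 = v$1" "u$2 = v$2"
    by (smt (verit) zero_le_power2 power2_eq_iff_nonneg zero_eq_power2)+
  with u v have "(u$3)\<^sup>2 = (v$3)\<^sup>2" by simp
  with u(2) v(2) have "u$3 = v$3" by (simp add: power2_eq_iff_nonneg)
  with 12 show "u = v" by (simp add: vec_eq_iff forall_3)
qed

lemma lorentz_Cauchy_Schwarz:
  assumes v: "v \<in> hyperboloid" and "lorentz x v = 0" "lorentz y v = 0"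
  shows "(lorentz x y)\<^sup>2 \<le> lorentz x x * lorentz y y"
proof -
  define n1 where "n1 = x$2 * y$3 - x$3 * y$2"
  define n2 where "n2 = x$3 * y$1 - x$1 * y$3"
  define n3 where "n3 = x$1 * y$2 - x$2 * y$1"
  have v3: "v$3 > 0" "(v$3)\<^sup>2 = 1 + (v$1)\<^sup>2 + (v$2)\<^sup>2"
    using v by (auto simp: hyperboloid_def lorentz_def power2_eq_square)
  have x3: "x$3 * v$3 = x$1 * v$1 + x$2 * v$2" and y3: "y$3 * v$3 = y$1 * v$1 + y$2 * v$2"
    using assms by (auto simp: lorentz_def)
  have id: "lorentz x x * lorentz y y - (lorentz x y)\<^sup>2 = n3\<^sup>2 - n1\<^sup>2 - n2\<^sup>2"
    by (simp add: lorentz_def n1_def n2_def n3_def power2_eq_square algebra_simps)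
  have "n1 * v$3 = x$2 * (y$3 * v$3) - (x$3 * v$3) * y$2"
    by (simp add: n1_def algebra_simps)
  also have "\<dots> = - n3 * v$1" unfolding x3 y3 by (simp add: n3_def algebra_simps)
  finally have 1: "n1 * v$3 = - n3 * v$1" .
  have "n2 * v$3 = (x$3 * v$3) * y$1 - x$1 * (y$3 * v$3)"
    by (simp add: n2_def algebra_simps)
  also have "\<dots> = - n3 * v$2" unfolding x3 y3 by (simp add: n3_def algebra_simps)
  finally have 2: "n2 * v$3 = - n3 * v$2" .
  have "(n3\<^sup>2 - n1\<^sup>2 - n2\<^sup>2) * (v$3)\<^sup>2 = n3\<^sup>2 * (v$3)\<^sup>2 - (n1 * v$3)\<^sup>2 - (n2 * v$3)\<^sup>2"
    by (simp add: algebra_simps power_mult_distrib)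
  also have "\<dots> = n3\<^sup>2" unfolding 1 2 v3(2) by (simp add: algebra_simps power_mult_distrib)
  finally have "(n3\<^sup>2 - n1\<^sup>2 - n2\<^sup>2) * (v$3)\<^sup>2 \<ge> 0" by simp
  then have "n3\<^sup>2 - n1\<^sup>2 - n2\<^sup>2 \<ge> 0" using v3(1) by (simp add: zero_le_mult_iff)
  with id show ?thesis by linarith
qed

lemma hyp_dist_triangle:
  assumes u: "u \<in> hyperboloid" and v: "v \<in> hyperboloid" and w: "w \<in> hyperboloid"
  shows "hyp_dist u w \<le> hyp_dist u v + hyp_dist v w"
proof -
  define a where "a = - lorentz u v"
  define b where "b = - lorentz v w"
  have a: "a \<ge> 1" and b: "b \<ge> 1" and c: "- lorentz u w \<ge> 1"
    using lorentz_le(1)[OF u v] lorentz_le(1)[OF v w] lorentz_le(1)[OF u w]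
    by (auto simp: a_def b_def)
  define x where "x = u - a *\<^sub>R v"
  define y where "y = w - b *\<^sub>R v"
  have nn: "lorentz u u = -1" "lorentz v v = -1" "lorentz w w = -1"
    using assms by (auto simp: hyperboloid_def)
  have exp: "lorentz (p - s *\<^sub>R v) (q - t *\<^sub>R v) =
      lorentz p q - t * lorentz p v - s * lorentz v q + s * t * lorentz v v" for p q s t
    by (simp add: lorentz_def algebra_simps)
  have exp1: "lorentz (p - s *\<^sub>R v) v = lorentz p v - s * lorentz v v" for p s
    by (simp add: lorentz_def algebra_simps)
  have "lorentz x v = 0" "lorentz y v = 0"
    using lorentz_commute[of w v] unfolding x_def y_def exp1 nn by (simp_all add: a_def b_def)
  from lorentz_Cauchy_Schwarz[OF v this]
  have "(lorentz x y)\<^sup>2 \<le> lorentz x x * lorentz y y" .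
  moreover have "lorentz x x = a\<^sup>2 - 1"
    using lorentz_commute[of u v] unfolding x_def exp nn
    by (simp add: a_def power2_eq_square algebra_simps)
  moreover have "lorentz y y = b\<^sup>2 - 1"
    using lorentz_commute[of w v] unfolding y_def exp nn
    by (simp add: b_def power2_eq_square algebra_simps)
  moreover have "lorentz x y = lorentz u w + a * b"
    unfolding x_def y_def exp nn by (simp add: a_def b_def algebra_simps)
  ultimately have "(lorentz u w + a * b)\<^sup>2 \<le> (a\<^sup>2 - 1) * (b\<^sup>2 - 1)" by simp
  then have "\<bar>lorentz u w + a * b\<bar> \<le> sqrt ((a\<^sup>2 - 1) * (b\<^sup>2 - 1))"
    using real_le_rsqrt by (metis power2_abs)
  then have "- lorentz u w \<le> a * b + sqrt (a\<^sup>2 - 1) * sqrt (b\<^sup>2 - 1)"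
    by (simp add: real_sqrt_mult abs_le_iff)
  also have "\<dots> = cosh (arcosh a + arcosh b)"
    using a b by (simp add: cosh_add sinh_arcosh_real)
  finally have "arcosh (- lorentz u w) \<le> arcosh (cosh (arcosh a + arcosh b))"
    using c by (smt (verit) arcosh_less_iff_real cosh_real_ge_1)
  also have "\<dots> = arcosh a + arcosh b"
    using a b by (intro arcosh_cosh_real add_nonneg_nonneg arcosh_nonneg_real)
  finally show ?thesis by (simp add: hyp_dist_def a_def b_def)
qed

lemma Metric_space_hyperboloid:
  assumes "c > 0"
  shows "Metric_space hyperboloid (\<lambda>u v. if u \<in> hyperboloid \<and> v \<in> hyperboloid then hyp_dist u v / c else 0)"
proof -
  have "0 \<le> hyp_dist u v" "hyp_dist u v = 0 \<longleftrightarrow> u = v" if "u \<in> hyperboloid" "v \<in> hyperboloid" for u v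
  proof -
    have ge: "1 \<le> - lorentz u v" using lorentz_le(1)[OF that] by simp
    then show "0 \<le> hyp_dist u v" unfolding hyp_dist_def by simp
    have "hyp_dist u v = 0 \<longleftrightarrow> lorentz u v = -1"
      using ge unfolding hyp_dist_def by (subst arcosh_eq_0_iff_real) auto
    also have "\<dots> \<longleftrightarrow> u = v"
      using lorentz_le(2)[OF that] that by (auto simp: hyperboloid_def)
    finally show "hyp_dist u v = 0 \<longleftrightarrow> u = v" .
  qed
  moreover have "hyp_dist u v = hyp_dist v u" for u v
    by (simp add: hyp_dist_def lorentz_commute)
  ultimately show ?thesis
    using assms
    by unfold_locales
      (auto simp: divide_right_mono hyp_dist_triangle simp flip: add_divide_distrib)
qed

lemma Metric_space_plane:
  "Metric_space S (\<lambda>u v. if u \<in> S \<and> v \<in> S then dist u v else 0)"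
  by unfold_locales (auto simp: dist_commute dist_triangle)

lemma mspace_metric_on:
  assumes "Metric_space S (\<lambda>x y. if x \<in> S \<and> y \<in> S then d x y else 0)"
  shows "mspace (metric_on S d) = S"
    and "\<lbrakk>x \<in> S; y \<in> S\<rbrakk> \<Longrightarrow> mdist (metric_on S d) x y = d x y"
  using assms by (simp_all add: metric_on_def Metric_space.mspace_metric Metric_space.mdist_metric)

lemma mspace_model_surface:
  "mspace (model_surface \<kappa>) =
     (if \<kappa> > 0 then sphere 0 1 else if \<kappa> = 0 then {u. u$3 = 0} else hyperboloid)"
  using mspace_metric_on(1)[OF Metric_space_sphere] mspace_metric_on(1)[OF Metric_space_plane]
    mspace_metric_on(1)[OF Metric_space_hyperboloid]
  by (auto simp: model_surface_def)

lemma mdist_model_surface: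
  assumes "u \<in> mspace (model_surface \<kappa>)" "v \<in> mspace (model_surface \<kappa>)"
  shows "mdist (model_surface \<kappa>) u v =
     (if \<kappa> > 0 then sphere_dist u v / sqrt \<kappa> else if \<kappa> = 0 then dist u v
      else hyp_dist u v / sqrt (- \<kappa>))"
  using assms mspace_metric_on(2)[OF Metric_space_sphere, of "sqrt \<kappa>" u v]
    mspace_metric_on(2)[OF Metric_space_plane, of u "{u. u$3 = 0}" v]
    mspace_metric_on(2)[OF Metric_space_hyperboloid, of "sqrt (- \<kappa>)" u v]
  unfolding mspace_model_surface by (auto simp: model_surface_def split: if_splits)

section \<open>Upper curvature bounds\<close>

definition in_convex_ball :: "'a metric \<Rightarrow> 'a set \<Rightarrow> bool" where
  "in_convex_ball X A \<longleftrightarrow>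
     (\<exists>c\<in>mspace X. \<exists>r>0. convex_in X (mball_of X c r) \<and> A \<subseteq> mball_of X c r)"

definition on_shortest_path :: "'a metric \<Rightarrow> 'a \<Rightarrow> 'a \<Rightarrow> 'a \<Rightarrow> bool" where
  "on_shortest_path X x z y \<longleftrightarrow> (\<exists>g. shortest_path X x z g \<and> y \<in> g ` {0..1})"

definition curvature_le :: "real \<Rightarrow> 'a metric \<Rightarrow> bool" where
  "curvature_le \<kappa> X \<longleftrightarrow> complete_length_space X \<and>
     (\<forall>x1 x2 x3 y.
        in_convex_ball X {x1, x2, x3} \<longrightarrow>
        (\<kappa> > 0 \<longrightarrow> mdist X x1 x2 + mdist X x2 x3 + mdist X x3 x1 < 2 * pi / sqrt \<kappa>) \<longrightarrow>
        on_shortest_path X x1 x3 y \<longrightarrow>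
        (\<forall>x1' \<in> mspace (model_surface \<kappa>). \<forall>x2' \<in> mspace (model_surface \<kappa>).
         \<forall>x3' \<in> mspace (model_surface \<kappa>). \<forall>y' \<in> mspace (model_surface \<kappa>).
           mdist (model_surface \<kappa>) x1' x2' = mdist X x1 x2 \<longrightarrow>
           mdist (model_surface \<kappa>) x2' x3' = mdist X x2 x3 \<longrightarrow>
           mdist (model_surface \<kappa>) x3' x1' = mdist X x3 x1 \<longrightarrow>
           on_shortest_path (model_surface \<kappa>) x1' x3' y' \<longrightarrow>
           mdist (model_surface \<kappa>) x1' y' = mdist X x1 y \<longrightarrow>
           mdist X y x2 \<le> mdist (model_surface \<kappa>) y' x2'))"

section \<open>Gromov--Hausdorff distance\<close>

text \<open>The infimum is taken in the extended reals, so the Hausdorff distance between the empty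
  set and a nonempty set is infinite.\<close>

definition hausdorff_dist :: "'a metric \<Rightarrow> 'a set \<Rightarrow> 'a set \<Rightarrow> ereal" where
  "hausdorff_dist Z A B =
     Inf {ereal r | r. r > 0 \<and> A \<subseteq> (\<Union>b\<in>B. mball_of Z b r) \<and> B \<subseteq> (\<Union>a\<in>A. mball_of Z a r)}"

definition isometric_embedding :: "'a metric \<Rightarrow> 'b metric \<Rightarrow> ('a \<Rightarrow> 'b) \<Rightarrow> bool" where
  "isometric_embedding X Z f \<longleftrightarrow> f ` mspace X \<subseteq> mspace Z \<and>
     (\<forall>x\<in>mspace X. \<forall>y\<in>mspace X. mdist Z (f x) (f y) = mdist X x y)"

text \<open>The infimum ranges over all metric spaces \<open>Z\<close> containing isometric copies of \<open>X\<close> and \<open>Y\<close>.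
  Only the union of the two copies matters, and it injects into the sum type, so nothing is lost
  by taking the points of \<open>Z\<close> there.\<close>

definition GH_dist :: "'a metric \<Rightarrow> 'b metric \<Rightarrow> ereal" where
  "GH_dist X Y =
     Inf {hausdorff_dist Z (f ` mspace X) (g ` mspace Y) | (Z :: ('a + 'b) metric) f g.
            isometric_embedding X Z f \<and> isometric_embedding Y Z g}"

text \<open>Total boundedness for the Gromov--Hausdorff distance, phrased with representatives of the
  isometry classes.\<close>

definition GH_precompact :: "'a metric set \<Rightarrow> bool" where
  "GH_precompact F \<longleftrightarrow> (\<forall>X\<in>F. compact_space (mtopology_of X)) \<and>
     (\<forall>\<epsilon>::real. \<epsilon> > 0 \<longrightarrow> (\<exists>K. finite K \<and> K \<subseteq> F \<and> (\<forall>X\<in>F. \<exists>Y\<in>K. GH_dist Y X < ereal \<epsilon>)))"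

section \<open>Homotopy types\<close>

definition same_homotopy_type :: "('a metric \<times> 'a metric) set" where
  "same_homotopy_type =
     {(X, Y). mtopology_of X homotopy_equivalent_space mtopology_of Y}"

definition homotopy_types :: "'a metric set \<Rightarrow> 'a metric set set" where
  "homotopy_types F = F // same_homotopy_type"

end

theory Submission
  imports Defs
begin

text \<open>Two spaces of the class at Gromov--Hausdorff distance less than \<open>\<rho>\<^sub>0 / 8\<close> are homotopy
  equivalent, so a finite \<open>\<rho>\<^sub>0 / 8\<close>-net of the family meets all homotopy types. A correspondence
  between \<open>X\<close> and \<open>Y\<close> of small distortion sends a finite net of \<open>X\<close> to points of \<open>Y\<close>. Interpolating
  these points along geodesics, with weights from bump functions around the net, gives a
  continuous map \<open>X \<rightarrow> Y\<close> which stays near the correspondence because small balls of \<open>Y\<close> are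
  convex. Such maps in the two directions compose to maps moving points by less than \<open>\<rho>\<^sub>0\<close>, and
  these are homotopic to the identity along the unique shortest paths.\<close>

section \<open>Topological preliminaries\<close>

lemma mdist_refl [simp]: "x \<in> mspace X \<Longrightarrow> mdist X x x = 0"
  by simp

lemma limitin_mtopology_of:
  "limitin (mtopology_of X) f l F \<longleftrightarrow>
     l \<in> mspace X \<and> (\<forall>\<^sub>F x in F. f x \<in> mspace X) \<and> ((\<lambda>x. mdist X (f x) l) \<longlongrightarrow> 0) F"
  unfolding mtopology_of_def
  by (rule Metric_space.limitin_metric_dist_null[OF Metric_space_mspace_mdist])

lemma limitin_mtopology_of_close:
  assumes f: "limitin (mtopology_of X) f l F" and e: "(e \<longlongrightarrow> 0) F"
    and close: "\<forall>\<^sub>F x in F. g x \<in> mspace X \<and> mdist X (g x) (f x) \<le> e x"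
  shows "limitin (mtopology_of X) g l F"
  unfolding limitin_mtopology_of
proof (intro conjI)
  have l: "l \<in> mspace X" and f_in: "\<forall>\<^sub>F x in F. f x \<in> mspace X"
    and fl: "((\<lambda>x. mdist X (f x) l) \<longlongrightarrow> 0) F"
    using f by (auto simp: limitin_mtopology_of)
  show "l \<in> mspace X" by (fact l)
  show "\<forall>\<^sub>F x in F. g x \<in> mspace X" using close by eventually_elim simp
  show "((\<lambda>x. mdist X (g x) l) \<longlongrightarrow> 0) F"
  proof (rule tendsto_sandwich[OF _ _ tendsto_const])
    show "\<forall>\<^sub>F x in F. mdist X (g x) l \<le> e x + mdist X (f x) l"
      using close f_in
    proof eventually_elim
      case (elim x)
      then show ?case using mdist_triangle[of "g x" X "f x" l] l by simp
    qed
    show "((\<lambda>x. e x + mdist X (f x) l) \<longlongrightarrow> 0) F" using tendsto_add[OF e fl] by simp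
  qed simp
qed

lemma eventually_atin_openin: "\<lbrakk>openin T U; x \<in> U\<rbrakk> \<Longrightarrow> \<forall>\<^sub>F u in atin T x. u \<in> U"
  unfolding eventually_atin by blast

lemma atin_within_open:
  assumes "openin T U" "x \<in> U"
  shows "atin_within T x U = atin T x"
proof (rule filter_eqI)
  fix P
  have "\<forall>\<^sub>F u in atin T x. (u \<in> U \<longrightarrow> P u) = P u"
    using eventually_atin_openin[OF assms] by eventually_elim simp
  then show "eventually P (atin_within T x U) = eventually P (atin T x)"
    unfolding eventually_within_imp[of P T x U] by (rule eventually_subst)
qed

lemma limitin_atin_open_subtopology:
  assumes f: "continuous_map (subtopology T U) Y f" and U: "openin T U" "x \<in> U"
  shows "limitin Y f (f x) (atin T x)"
  using limit_continuous_map_within[OF f U(2)] openin_subset[OF U(1)] U(2)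
  by (auto simp: atin_within_open[OF U])

lemma continuous_map_if_closed_graph:
  assumes Y: "compact_space Y" and f: "\<And>x. x \<in> topspace X \<Longrightarrow> f x \<in> topspace Y"
    and graph: "closedin (prod_topology X Y) {(x, y). x \<in> topspace X \<and> y = f x}" (is "closedin _ ?G")
  shows "continuous_map X Y f"
  unfolding continuous_map_closedin
proof (intro conjI allI impI)
  fix C assume "closedin Y C"
  then have "closedin (prod_topology X Y) (?G \<inter> topspace X \<times> C)"
    using graph by (intro closedin_Int) (simp_all add: closedin_prod_Times_iff)
  then have "closedin X (fst ` (?G \<inter> topspace X \<times> C))"
    using closed_map_fst[OF Y] by (auto simp: closed_map_def)
  also have "fst ` (?G \<inter> topspace X \<times> C) = {x \<in> topspace X. f x \<in> C}" by force
  finally show "closedin X {x \<in> topspace X. f x \<in> C}" .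
qed (use f in auto)

lemma pathin_concat:
  assumes g: "pathin T g" and h: "pathin T h" and gh: "g 1 = h 0"
  shows "pathin T (\<lambda>t. if t \<le> 1/2 then g (2 * t) else h (2 * t - 1))"
proof -
  let ?I = "top_of_set {0..1::real}"
  have left: "continuous_map (subtopology ?I {t \<in> topspace ?I. t \<le> 1/2}) T (g \<circ> (\<lambda>t. 2 * t))"
    using g unfolding pathin_def
    by (intro continuous_map_compose)
       (auto simp: continuous_map_in_subtopology subtopology_subtopology intro!: continuous_intros)
  have right: "continuous_map (subtopology ?I {t \<in> topspace ?I. 1/2 \<le> t}) T (h \<circ> (\<lambda>t. 2 * t - 1))"
    using h unfolding pathin_def
    by (intro continuous_map_compose)
       (auto simp: continuous_map_in_subtopology subtopology_subtopology intro!: continuous_intros)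
  have "continuous_map ?I T (\<lambda>t. if t \<le> 1/2 then (g \<circ> (\<lambda>t. 2 * t)) t else (h \<circ> (\<lambda>t. 2 * t - 1)) t)"
  proof (rule continuous_map_cases_le[OF _ _ left right])
    fix t :: real assume "t = 1/2"
    show "(g \<circ> (\<lambda>t. 2 * t)) t = (h \<circ> (\<lambda>t. 2 * t - 1)) t"
      unfolding \<open>t = 1/2\<close> by (simp add: gh)
  qed auto
  then show ?thesis unfolding pathin_def o_def .
qed

lemma compact_space_bump_functions:
  assumes X: "compact_space (mtopology_of X)" and \<epsilon>: "0 < \<epsilon>"
  obtains K and w :: "'a \<Rightarrow> 'a \<Rightarrow> real" where "finite K" "K \<subseteq> mspace X"
    "\<And>p. p \<in> K \<Longrightarrow> continuous_map (mtopology_of X) euclideanreal (w p)" "\<And>p x. 0 \<le> w p x"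
    "\<And>p x. 0 < w p x \<longleftrightarrow> mdist X p x < \<epsilon>" "\<And>x. x \<in> mspace X \<Longrightarrow> 0 < (\<Sum>p\<in>K. w p x)"
proof -
  obtain K where K: "finite K" "K \<subseteq> mspace X" "mspace X \<subseteq> (\<Union>p\<in>K. mball_of X p \<epsilon>)"
    using X \<epsilon> unfolding mtopology_of_def mball_of_def
      Metric_space.compact_space_eq_mcomplete_mtotally_bounded[OF Metric_space_mspace_mdist]
      Metric_space.mtotally_bounded_def[OF Metric_space_mspace_mdist] by blast
  define w where "w p x = max 0 (\<epsilon> - mdist X p x)" for p x
  show thesis
  proof (rule that[OF K(1,2)])
    show "continuous_map (mtopology_of X) euclideanreal (w p)" if "p \<in> K" for p
      unfolding w_def using that K(2) by (intro continuous_intros continuous_map_mdist) auto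
    show "0 \<le> w p x" and w_pos: "0 < w p x \<longleftrightarrow> mdist X p x < \<epsilon>" for p x
      by (auto simp: w_def)
    fix x assume "x \<in> mspace X"
    then obtain p where "p \<in> K" "0 < w p x" using K(3) by (auto simp: w_pos)
    then show "0 < (\<Sum>p\<in>K. w p x)" using K(1) by (intro sum_pos2[of _ p]) (auto simp: w_def)
  qed
qed

section \<open>Shortest paths and metric segments\<close>

lemma joins_in_mspace: "\<lbrakk>joins X x y g; t \<in> {0..1}\<rbrakk> \<Longrightarrow> g t \<in> mspace X"
  by (auto simp: joins_def pathin_def continuous_map_def)

lemma joins_endpoints_in_mspace:
  assumes "joins X x y g"
  shows "x \<in> mspace X" "y \<in> mspace X"
  using joins_in_mspace[OF assms, of 0] joins_in_mspace[OF assms, of 1] assms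
  by (auto simp: joins_def)

lemma sum_mdist_le_path_length:
  assumes "mono_on {..n} t" "t 0 = 0" "t n = 1"
  shows "ereal (\<Sum>i<n. mdist X (g (t i)) (g (t (Suc i)))) \<le> path_length X g"
  unfolding path_length_def using assms by (intro Sup_upper) blast

lemma mdist_le_path_length: "ereal (mdist X (g 0) (g 1)) \<le> path_length X g"
  using sum_mdist_le_path_length[of 1 real X g] by (simp add: mono_on_def)

lemma shortest_path_mdist_le:
  assumes g: "shortest_path X x y g" and st: "0 \<le> s" "s \<le> t" "t \<le> 1"
  shows "mdist X x (g s) + mdist X (g s) (g t) + mdist X (g t) y \<le> mdist X x y"
proof -
  define \<tau> :: "nat \<Rightarrow> real" where
    "\<tau> = (\<lambda>i. if i = 0 then 0 else if i = 1 then s else if i = 2 then t else 1)"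
  have "mono_on {..3} \<tau>" "\<tau> 0 = 0" "\<tau> 3 = 1"
    using st by (auto simp: \<tau>_def mono_on_def)
  then have "ereal (\<Sum>i<3. mdist X (g (\<tau> i)) (g (\<tau> (Suc i)))) \<le> path_length X g"
    by (rule sum_mdist_le_path_length)
  then show ?thesis
    using g by (simp add: shortest_path_def joins_def \<tau>_def numeral_3_eq_3)
qed

lemma shortest_pathI:
  assumes g: "joins X x y g"
    and le: "\<And>s t. \<lbrakk>0 \<le> s; s \<le> t; t \<le> 1\<rbrakk> \<Longrightarrow>
      mdist X x (g s) + mdist X (g s) (g t) + mdist X (g t) y \<le> mdist X x y"
  shows "shortest_path X x y g"
proof -
  have ends: "g 0 = x" "g 1 = y" using g by (auto simp: joins_def)
  note in_space = joins_in_mspace[OF g] joins_endpoints_in_mspace[OF g]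
  have increment: "mdist X (g s) (g t) \<le> mdist X x (g t) - mdist X x (g s)"
    if "0 \<le> s" "s \<le> t" "t \<le> 1" for s t
    using le[OF that] mdist_triangle[of x X "g t" y] in_space that by simp
  have "(\<Sum>i<n. mdist X (g (t i)) (g (t (Suc i)))) \<le> mdist X x y"
    if t: "mono_on {..n} t" "t 0 = 0" "t n = 1" for n and t :: "nat \<Rightarrow> real"
  proof -
    have "(\<Sum>i<n. mdist X (g (t i)) (g (t (Suc i))))
        \<le> (\<Sum>i<n. mdist X x (g (t (Suc i))) - mdist X x (g (t i)))"
    proof (intro sum_mono increment)
      fix i assume "i \<in> {..<n}"
      then show "0 \<le> t i" "t i \<le> t (Suc i)" "t (Suc i) \<le> 1"
        using mono_onD[OF t(1), of 0 i] mono_onD[OF t(1), of i "Suc i"]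
          mono_onD[OF t(1), of "Suc i" n] t by auto
    qed
    also have "\<dots> = mdist X x y"
      using sum_lessThan_telescope[of "\<lambda>i. mdist X x (g (t i))" n] t in_space by (simp add: ends)
    finally show ?thesis .
  qed
  then have "path_length X g \<le> ereal (mdist X x y)"
    unfolding path_length_def by (intro Sup_least) auto
  then show ?thesis
    using g mdist_le_path_length[of X g] by (simp add: shortest_path_def ends)
qed

definition metric_segment :: "'a metric \<Rightarrow> 'a \<Rightarrow> 'a \<Rightarrow> 'a set" where
  "metric_segment X x y = {m \<in> mspace X. mdist X x m + mdist X m y = mdist X x y}"

lemma shortest_path_concat:
  assumes g: "shortest_path X x m g" and h: "shortest_path X m y h"
    and m: "m \<in> metric_segment X x y"
  shows "shortest_path X x y (\<lambda>t. if t \<le> 1/2 then g (2 * t) else h (2 * t - 1))"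
    (is "shortest_path X x y ?p")
proof (rule shortest_pathI)
  have joins: "joins X x m g" "joins X m y h" using g h by (auto simp: shortest_path_def)
  then show "joins X x y ?p" using pathin_concat[of "mtopology_of X" g h] by (simp add: joins_def)
  note in_space = joins_endpoints_in_mspace[OF joins(1)] joins_endpoints_in_mspace[OF joins(2)]
  have split: "mdist X x m + mdist X m y = mdist X x y" using m by (simp add: metric_segment_def)
  fix s t :: real assume st: "0 \<le> s" "s \<le> t" "t \<le> 1"
  consider (left) "t \<le> 1/2" | (across) "s \<le> 1/2" "1/2 < t" | (right) "1/2 < s" by linarith
  then show "mdist X x (?p s) + mdist X (?p s) (?p t) + mdist X (?p t) y \<le> mdist X x y"
  proof cases
    case left
    then have "g (2 * t) \<in> mspace X" using joins_in_mspace[OF joins(1)] st by simp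
    then show ?thesis
      using left st shortest_path_mdist_le[OF g, of "2 * s" "2 * t"] split in_space
        mdist_triangle[of "g (2 * t)" X m y] by simp
  next
    case across
    then have "g (2 * s) \<in> mspace X" "h (2 * t - 1) \<in> mspace X"
      using joins_in_mspace[OF joins(1)] joins_in_mspace[OF joins(2)] st by simp_all
    then show ?thesis
      using across st shortest_path_mdist_le[OF g, of "2 * s" "2 * s"]
        shortest_path_mdist_le[OF h, of "2 * t - 1" "2 * t - 1"] split in_space
        mdist_triangle[of "g (2 * s)" X m "h (2 * t - 1)"] by simp
  next
    case right
    then have "h (2 * s - 1) \<in> mspace X" using joins_in_mspace[OF joins(2)] st by simp
    then show ?thesis
      using right st shortest_path_mdist_le[OF h, of "2 * s - 1" "2 * t - 1"] split in_space
        mdist_triangle[of x X m "h (2 * s - 1)"] by simp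
  qed
qed

lemma shortest_path_image_subset:
  assumes g: "shortest_path X x y g"
  shows "g ` {0..1} \<subseteq> metric_segment X x y"
proof
  fix m assume "m \<in> g ` {0..1}"
  then obtain t where t: "t \<in> {0..1}" "m = g t" by blast
  have joins: "joins X x y g" using g by (simp add: shortest_path_def)
  have "m \<in> mspace X" using joins_in_mspace[OF joins] t by simp
  moreover have "mdist X x m + mdist X m y \<le> mdist X x y"
    using shortest_path_mdist_le[OF g, of t t] t joins_in_mspace[OF joins] by simp
  ultimately show "m \<in> metric_segment X x y"
    using mdist_triangle[of x X m y] joins_endpoints_in_mspace[OF joins]
    by (simp add: metric_segment_def)
qed

lemma shortest_path_inj_on_mdist:
  assumes g: "shortest_path X x y g"
  shows "inj_on (mdist X x) (g ` {0..1})"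
proof -
  have joins: "joins X x y g" using g by (simp add: shortest_path_def)
  note in_space = joins_in_mspace[OF joins] joins_endpoints_in_mspace[OF joins]
  have "g s = g t"
    if "s \<in> {0..1}" "t \<in> {0..1}" "mdist X x (g s) = mdist X x (g t)" for s t
    using that
  proof (induction s t rule: linorder_wlog)
    case (le s t)
    then have "mdist X (g s) (g t) \<le> 0"
      using shortest_path_mdist_le[OF g, of s t] mdist_triangle[of x X "g t" y] in_space by simp
    then show ?case
      using le in_space mdist_zero[of "g s" X "g t"] mdist_nonneg[of X "g s" "g t"] by simp
  qed simp
  then show ?thesis by (auto simp: inj_on_def)
qed

lemma metric_segment_point_exists:
  assumes X: "complete_length_space X" and xy: "x \<in> mspace X" "y \<in> mspace X" and t: "t \<in> {0..1}"
  shows "\<exists>m\<in>metric_segment X x y. mdist X x m = t * mdist X x y"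
proof -
  obtain g where g: "shortest_path X x y g"
    using X xy unfolding complete_length_space_def by blast
  then have ends: "g 0 = x" "g 1 = y" and p: "pathin (mtopology_of X) g"
    by (auto simp: shortest_path_def joins_def)
  have "continuous_map (top_of_set {0..1}) euclidean (\<lambda>u. mdist X x (g u))"
    using p xy by (intro continuous_map_mdist) (auto simp: pathin_def)
  then have "continuous_on {0..1} (\<lambda>u. mdist X x (g u))" by simp
  moreover have "mdist X x (g 0) \<le> t * mdist X x y" "t * mdist X x y \<le> mdist X x (g 1)"
    using t xy by (auto simp: ends mult_left_le_one_le)
  ultimately obtain u where "u \<in> {0..1}" "mdist X x (g u) = t * mdist X x y"
    using IVT'[of "\<lambda>u. mdist X x (g u)" 0 "t * mdist X x y" 1] by auto
  then show ?thesis using shortest_path_image_subset[OF g] by blast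
qed

section \<open>Convexity\<close>

lemma reparametrization_image:
  assumes "reparametrization \<phi>"
  shows "\<phi> ` {0..1} = {0..1}"
proof -
  have "\<phi> 0 \<le> \<phi> u" "\<phi> u \<le> \<phi> 1" if "u \<in> {0..1}" for u
    using assms that mono_onD[of "{0..1}" \<phi> 0 u] mono_onD[of "{0..1}" \<phi> u 1]
    by (auto simp: reparametrization_def)
  moreover have "u \<in> \<phi> ` {0..1}" if "u \<in> {0..1}" for u
    using IVT'[of \<phi> 0 u 1] assms that by (auto simp: reparametrization_def)
  ultimately show ?thesis using assms by (fastforce simp: reparametrization_def)
qed

lemma same_path_image:
  assumes "same_path g h"
  shows "g ` {0..1} = h ` {0..1}"
proof -
  obtain \<phi> \<psi> where \<phi>: "reparametrization \<phi>" and \<psi>: "reparametrization \<psi>"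
    and eq: "\<And>t. t \<in> {0..1} \<Longrightarrow> g (\<phi> t) = h (\<psi> t)"
    using assms by (auto simp: same_path_def)
  have "g ` \<phi> ` {0..1} = h ` \<psi> ` {0..1}" using eq by (simp add: image_image)
  then show ?thesis using \<phi> \<psi> by (simp add: reparametrization_image)
qed

text \<open>A point of the metric segment lies on a shortest path, obtained by concatenation, hence on
  the unique one provided by convexity.\<close>

lemma convex_in_shortest_path:
  assumes X: "complete_length_space X" and A: "convex_in X A" and xy: "x \<in> A" "y \<in> A"
  obtains g where "shortest_path X x y g" "g ` {0..1} = metric_segment X x y"
    "metric_segment X x y \<subseteq> A"
proof -
  obtain g where g: "shortest_path X x y g" "g ` {0..1} \<subseteq> A"
    and unique: "\<And>h. shortest_path X x y h \<Longrightarrow> same_path g h"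
    using A xy unfolding convex_in_def by blast
  have "m \<in> g ` {0..1}" if m: "m \<in> metric_segment X x y" for m
  proof -
    have "x \<in> mspace X" "y \<in> mspace X" "m \<in> mspace X"
      using A xy m by (auto simp: convex_in_def metric_segment_def)
    then obtain h k where h: "shortest_path X x m h" and k: "shortest_path X m y k"
      using X unfolding complete_length_space_def by blast
    define p where "p t = (if t \<le> 1/2 then h (2 * t) else k (2 * t - 1))" for t
    have "shortest_path X x y p" unfolding p_def by (rule shortest_path_concat[OF h k m])
    then have "g ` {0..1} = p ` {0..1}" by (intro same_path_image unique)
    moreover have "p (1/2) = m" using h by (simp add: p_def shortest_path_def joins_def)
    then have "m \<in> p ` {0..1}" by force
    ultimately show ?thesis by simp
  qed
  then have "g ` {0..1} = metric_segment X x y" using shortest_path_image_subset[OF g(1)] by blast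
  with g show thesis using that by metis
qed

lemma convexity_radius_convex_in_mball:
  assumes "ereal \<rho> \<le> convexity_radius X" "x \<in> mspace X" "0 < s" "s < \<rho>"
  shows "convex_in X (mball_of X x s)"
proof -
  have "ereal s < convexity_radius X"
    using assms by (meson ereal_less_eq(3) less_le_trans less_ereal.simps(1))
  also have "\<dots> \<le> (SUP r\<in>{r. 0 \<le> r \<and> (\<forall>s. 0 < s \<and> s < r \<longrightarrow> convex_in X (mball_of X x s))}. ereal r)"
    unfolding convexity_radius_def using assms(2) by (rule INF_lower)
  finally show ?thesis using assms(3) by (auto simp: less_SUP_iff)
qed

locale convexity_radius_ge =
  fixes X :: "'a metric" and \<rho> :: real
  assumes complete_length: "complete_length_space X"
    and convexity_radius: "ereal \<rho> \<le> convexity_radius X"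
begin

lemma mball_metric_segment_subset:
  assumes z: "z \<in> mspace X" and xy: "x \<in> mball_of X z s" "y \<in> mball_of X z s" and s: "s \<le> \<rho>"
  shows "metric_segment X x y \<subseteq> mball_of X z s"
proof -
  have "max (mdist X z x) (mdist X z y) < s" using xy by simp
  then obtain r where r: "mdist X z x < r" "mdist X z y < r" "r < s"
    using dense[of "max (mdist X z x) (mdist X z y)" s] by auto
  then have "0 < r" using mdist_nonneg[of X z x] by linarith
  then have "convex_in X (mball_of X z r)"
    using convexity_radius_convex_in_mball[OF convexity_radius z] r s by simp
  moreover have "x \<in> mball_of X z r" "y \<in> mball_of X z r" using xy r by auto
  ultimately have "metric_segment X x y \<subseteq> mball_of X z r"
    by (rule convex_in_shortest_path[OF complete_length])
  also have "\<dots> \<subseteq> mball_of X z s" using r by auto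
  finally show ?thesis .
qed

lemma inj_on_mdist_metric_segment:
  assumes xy: "x \<in> mspace X" "y \<in> mspace X" and d: "mdist X x y < \<rho>"
  shows "inj_on (mdist X x) (metric_segment X x y)"
proof -
  obtain r where r: "mdist X x y < r" "r < \<rho>" using dense[OF d] by blast
  then have "0 < r" using mdist_nonneg[of X x y] by linarith
  then have "convex_in X (mball_of X x r)"
    using convexity_radius_convex_in_mball[OF convexity_radius xy(1)] r by simp
  moreover have "x \<in> mball_of X x r" "y \<in> mball_of X x r"
    using xy r \<open>0 < r\<close> by auto
  ultimately obtain g where "shortest_path X x y g" "g ` {0..1} = metric_segment X x y"
    by (rule convex_in_shortest_path[OF complete_length])
  then show ?thesis using shortest_path_inj_on_mdist by metis
qed

end

section \<open>Geodesic interpolation\<close>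

text \<open>As the endpoints are prescribed, the interpolation between two points is meaningful at
  \<open>t = 0\<close> and \<open>t = 1\<close> even if the opposite point lies outside of the space.\<close>

definition geodesic_point :: "'a metric \<Rightarrow> 'a \<Rightarrow> 'a \<Rightarrow> real \<Rightarrow> 'a" where
  "geodesic_point X x y t =
     (if t = 0 then x else if t = 1 then y
      else SOME m. m \<in> metric_segment X x y \<and> mdist X x m = t * mdist X x y)"

lemma geodesic_point_0 [simp]: "geodesic_point X x y 0 = x"
  and geodesic_point_1 [simp]: "geodesic_point X x y 1 = y"
  by (simp_all add: geodesic_point_def)

lemma
  assumes X: "complete_length_space X" and xy: "x \<in> mspace X" "y \<in> mspace X" and t: "t \<in> {0..1}"
  shows geodesic_point_in_metric_segment: "geodesic_point X x y t \<in> metric_segment X x y"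
    and mdist_geodesic_point: "mdist X x (geodesic_point X x y t) = t * mdist X x y"
proof -
  have "geodesic_point X x y t \<in> metric_segment X x y \<and>
      mdist X x (geodesic_point X x y t) = t * mdist X x y"
  proof (cases "t = 0 \<or> t = 1")
    case True
    then show ?thesis using xy by (auto simp: metric_segment_def)
  next
    case False
    then show ?thesis
      using someI_ex[OF metric_segment_point_exists[OF X xy t, unfolded Bex_def]]
      by (simp add: geodesic_point_def)
  qed
  then show "geodesic_point X x y t \<in> metric_segment X x y"
    "mdist X x (geodesic_point X x y t) = t * mdist X x y" by auto
qed

lemma mdist_geodesic_point_right:
  assumes "complete_length_space X" "x \<in> mspace X" "y \<in> mspace X" "t \<in> {0..1}"
  shows "mdist X (geodesic_point X x y t) y = (1 - t) * mdist X x y"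
  using geodesic_point_in_metric_segment[OF assms] mdist_geodesic_point[OF assms]
  by (simp add: metric_segment_def algebra_simps)

lemma geodesic_point_near_left:
  assumes "complete_length_space X" "t \<in> {0..1}" "x \<in> mspace X"
    and "t = 0 \<or> y \<in> mspace X \<and> mdist X x y \<le> c"
  shows "geodesic_point X x y t \<in> mspace X \<and> mdist X (geodesic_point X x y t) x \<le> t * c"
proof (cases "t = 0")
  case True
  then show ?thesis using assms(3) by simp
next
  case False
  then have y: "y \<in> mspace X" and "mdist X x y \<le> c" using assms(4) by auto
  moreover note geodesic_point_in_metric_segment[OF assms(1,3) y assms(2)]
    mdist_geodesic_point[OF assms(1,3) y assms(2)]
  ultimately show ?thesis
    using assms(2) by (simp add: metric_segment_def mdist_commute[of X _ x] mult_left_mono)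
qed

lemma geodesic_point_near_right:
  assumes "complete_length_space X" "t \<in> {0..1}" "y \<in> mspace X"
    and "t = 1 \<or> x \<in> mspace X \<and> mdist X x y \<le> c"
  shows "geodesic_point X x y t \<in> mspace X \<and> mdist X (geodesic_point X x y t) y \<le> (1 - t) * c"
proof (cases "t = 1")
  case True
  then show ?thesis using assms(3) by simp
next
  case False
  then have x: "x \<in> mspace X" and "mdist X x y \<le> c" using assms(4) by auto
  moreover note geodesic_point_in_metric_segment[OF assms(1) x assms(3,2)]
    mdist_geodesic_point_right[OF assms(1) x assms(3,2)]
  ultimately show ?thesis
    using assms(2) by (simp add: metric_segment_def mult_left_mono)
qed

lemma limitin_geodesic_point_left:
  assumes X: "complete_length_space X" and f: "limitin (mtopology_of X) f a F" and t: "(t \<longlongrightarrow> 0) F"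
    and ev: "\<forall>\<^sub>F u in F. t u \<in> {0..1} \<and> (t u = 0 \<or> g u \<in> mspace X \<and> mdist X (f u) (g u) \<le> c)"
  shows "limitin (mtopology_of X) (\<lambda>u. geodesic_point X (f u) (g u) (t u)) a F"
proof (rule limitin_mtopology_of_close[OF f])
  show "((\<lambda>u. t u * c) \<longlongrightarrow> 0) F" using t by (rule tendsto_mult_left_zero)
  have "\<forall>\<^sub>F u in F. f u \<in> mspace X" using f by (simp add: limitin_mtopology_of)
  with ev show "\<forall>\<^sub>F u in F. geodesic_point X (f u) (g u) (t u) \<in> mspace X \<and>
      mdist X (geodesic_point X (f u) (g u) (t u)) (f u) \<le> t u * c"
    by eventually_elim (intro geodesic_point_near_left[OF X], auto)
qed

lemma limitin_geodesic_point_right: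
  assumes X: "complete_length_space X" and g: "limitin (mtopology_of X) g b F" and t: "(t \<longlongrightarrow> 1) F"
    and ev: "\<forall>\<^sub>F u in F. t u \<in> {0..1} \<and> (t u = 1 \<or> f u \<in> mspace X \<and> mdist X (f u) (g u) \<le> c)"
  shows "limitin (mtopology_of X) (\<lambda>u. geodesic_point X (f u) (g u) (t u)) b F"
proof (rule limitin_mtopology_of_close[OF g])
  have "((\<lambda>u. 1 - t u) \<longlongrightarrow> 0) F" using tendsto_diff[OF tendsto_const[of 1] t] by simp
  then show "((\<lambda>u. (1 - t u) * c) \<longlongrightarrow> 0) F" by (rule tendsto_mult_left_zero)
  have "\<forall>\<^sub>F u in F. g u \<in> mspace X" using g by (simp add: limitin_mtopology_of)
  with ev show "\<forall>\<^sub>F u in F. geodesic_point X (f u) (g u) (t u) \<in> mspace X \<and>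
      mdist X (geodesic_point X (f u) (g u) (t u)) (g u) \<le> (1 - t u) * c"
    by eventually_elim (intro geodesic_point_near_right[OF X], auto)
qed

locale compact_convexity_radius_ge = convexity_radius_ge +
  assumes compact: "compact_space (mtopology_of X)"
begin

text \<open>Below the convexity radius, the geodesic points are the only ones dividing the distance in the
  given ratio, so their graph is cut out by equations between continuous functions.\<close>

lemma continuous_map_geodesic_point:
  assumes f: "continuous_map T (mtopology_of X) f" and g: "continuous_map T (mtopology_of X) g"
    and t: "continuous_map T euclideanreal t"
    and t01: "\<And>u. u \<in> topspace T \<Longrightarrow> t u \<in> {0..1}"
    and near: "\<And>u. u \<in> topspace T \<Longrightarrow> mdist X (f u) (g u) < \<rho>"
  shows "continuous_map T (mtopology_of X) (\<lambda>u. geodesic_point X (f u) (g u) (t u))"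
    (is "continuous_map _ _ ?h")
proof (rule continuous_map_if_closed_graph[OF compact])
  let ?P = "prod_topology T (mtopology_of X)"
  have in_space: "f u \<in> mspace X" "g u \<in> mspace X" if "u \<in> topspace T" for u
    using f g that by (auto simp: continuous_map_def)
  have segment: "?h u \<in> metric_segment X (f u) (g u)"
    and ratio: "mdist X (f u) (?h u) = t u * mdist X (f u) (g u)" if "u \<in> topspace T" for u
    by (fact geodesic_point_in_metric_segment[OF complete_length in_space[OF that] t01[OF that]],
        fact mdist_geodesic_point[OF complete_length in_space[OF that] t01[OF that]])
  show "?h u \<in> topspace (mtopology_of X)" if "u \<in> topspace T" for u
    using segment[OF that] by (simp add: metric_segment_def)
  have unique: "m = ?h u"
    if "u \<in> topspace T" "m \<in> metric_segment X (f u) (g u)"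
      "mdist X (f u) m = t u * mdist X (f u) (g u)"
    for u m
    using inj_onD[OF inj_on_mdist_metric_segment[OF in_space near] _ that(2) segment] ratio that
    by simp
  define Segment where "Segment = {p \<in> topspace ?P.
    mdist X (f (fst p)) (snd p) + mdist X (snd p) (g (fst p)) = mdist X (f (fst p)) (g (fst p))}"
  define Ratio where "Ratio = {p \<in> topspace ?P.
    mdist X (f (fst p)) (snd p) = t (fst p) * mdist X (f (fst p)) (g (fst p))}"
  note cont = continuous_map_mdist continuous_map_add continuous_map_real_mult continuous_map_snd
    continuous_map_compose[OF continuous_map_fst f, unfolded o_def]
    continuous_map_compose[OF continuous_map_fst g, unfolded o_def]
    continuous_map_compose[OF continuous_map_fst t, unfolded o_def]
  have "closedin ?P Segment"
    unfolding Segment_def by (intro closedin_continuous_maps_eq[OF Hausdorff_space_euclidean] cont)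
  moreover have "closedin ?P Ratio"
    unfolding Ratio_def by (intro closedin_continuous_maps_eq[OF Hausdorff_space_euclidean] cont)
  moreover have "{(u, m). u \<in> topspace T \<and> m = ?h u} = Segment \<inter> Ratio"
    using segment ratio unique by (fastforce simp: Segment_def Ratio_def metric_segment_def)
  ultimately show "closedin ?P {(u, m). u \<in> topspace T \<and> m = ?h u}" by (simp add: closedin_Int)
qed

lemma nearby_maps_homotopic:
  assumes f: "continuous_map T (mtopology_of X) f" and g: "continuous_map T (mtopology_of X) g"
    and near: "\<And>x. x \<in> topspace T \<Longrightarrow> mdist X (f x) (g x) < \<rho>"
  shows "homotopic_with (\<lambda>_. True) T (mtopology_of X) f g"
proof -
  let ?P = "prod_topology (top_of_set {0..1::real}) T"
  have "continuous_map ?P (mtopology_of X) (\<lambda>p. geodesic_point X ((f \<circ> snd) p) ((g \<circ> snd) p) (fst p))"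
    using f g near
    by (intro continuous_map_geodesic_point continuous_map_compose[OF continuous_map_snd]
        continuous_map_into_fulltopology[OF continuous_map_fst]) auto
  then show ?thesis
    unfolding homotopic_with_def
    by (intro exI[of _ "\<lambda>p. geodesic_point X ((f \<circ> snd) p) ((g \<circ> snd) p) (fst p)"]) simp
qed

lemma continuous_map_geodesic_glue:
  assumes t: "continuous_map T euclideanreal t" and t01: "\<And>u. u \<in> topspace T \<Longrightarrow> t u \<in> {0..1}"
    and f: "continuous_map (subtopology T {u \<in> topspace T. t u \<noteq> 1}) (mtopology_of X) f"
    and g: "continuous_map (subtopology T {u \<in> topspace T. t u \<noteq> 0}) (mtopology_of X) g"
    and near: "\<And>u. \<lbrakk>u \<in> topspace T; t u \<noteq> 0; t u \<noteq> 1\<rbrakk> \<Longrightarrow> mdist X (f u) (g u) < \<rho>"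
  shows "continuous_map T (mtopology_of X) (\<lambda>u. geodesic_point X (f u) (g u) (t u))"
    (is "continuous_map _ _ ?h")
  unfolding continuous_map_atin
proof
  define U where "U = {u \<in> topspace T. t u \<noteq> 1}"
  define V where "V = {u \<in> topspace T. t u \<noteq> 0}"
  note f = f[folded U_def] and g = g[folded V_def]
  have U: "openin T U" and V: "openin T V"
    using openin_continuous_map_preimage[OF t, of "- {1}"]
      openin_continuous_map_preimage[OF t, of "- {0}"]
    by (simp_all add: U_def V_def open_Compl)
  have f_in: "f u \<in> mspace X" if "u \<in> U" for u
    using f that by (auto simp: continuous_map_def U_def)
  have g_in: "g u \<in> mspace X" if "u \<in> V" for u
    using g that by (auto simp: continuous_map_def V_def)
  fix x assume x: "x \<in> topspace T"
  have tx: "(t \<longlongrightarrow> t x) (atin T x)" using limitin_continuous_map[OF t x refl] by simp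
  consider (left) "t x = 0" | (right) "t x = 1" | (interior) "x \<in> U \<inter> V"
    using x by (auto simp: U_def V_def)
  then show "limitin (mtopology_of X) ?h (?h x) (atin T x)"
  proof cases
    case left
    then have xU: "x \<in> U" using x by (simp add: U_def)
    have "\<forall>\<^sub>F u in atin T x. t u \<in> {0..1} \<and> (t u = 0 \<or> g u \<in> mspace X \<and> mdist X (f u) (g u) \<le> \<rho>)"
      by (rule eventually_mono[OF eventually_atin_openin[OF U xU]])
         (use t01 g_in less_imp_le[OF near] in \<open>auto simp: U_def V_def\<close>)
    with limitin_atin_open_subtopology[OF f U xU] tx left show ?thesis
      using limitin_geodesic_point_left[OF complete_length] by simp
  next
    case right
    then have xV: "x \<in> V" using x by (simp add: V_def)
    have "\<forall>\<^sub>F u in atin T x. t u \<in> {0..1} \<and> (t u = 1 \<or> f u \<in> mspace X \<and> mdist X (f u) (g u) \<le> \<rho>)"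
      by (rule eventually_mono[OF eventually_atin_openin[OF V xV]])
         (use t01 f_in less_imp_le[OF near] in \<open>auto simp: U_def V_def\<close>)
    with limitin_atin_open_subtopology[OF g V xV] tx right show ?thesis
      using limitin_geodesic_point_right[OF complete_length] by simp
  next
    case interior
    have "continuous_map (subtopology T (U \<inter> V)) (mtopology_of X) ?h"
      using near t01
      by (intro continuous_map_geodesic_point continuous_map_from_subtopology[OF t]
          continuous_map_from_subtopology_mono[OF f] continuous_map_from_subtopology_mono[OF g])
         (auto simp: U_def V_def)
    then show ?thesis using interior by (rule limitin_atin_open_subtopology[OF _ openin_Int[OF U V]])
  qed
qed

text \<open>The last clause says that \<open>h u\<close> lies in the convex hull of the points of positive weight at
  \<open>u\<close>, as far as balls can see it.\<close>

definition interpolates ::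
  "'b topology \<Rightarrow> 'i set \<Rightarrow> ('i \<Rightarrow> 'b \<Rightarrow> real) \<Rightarrow> ('i \<Rightarrow> 'a) \<Rightarrow> ('b \<Rightarrow> 'a) \<Rightarrow> bool" where
  "interpolates T I w y h \<longleftrightarrow>
     continuous_map (subtopology T {u. 0 < (\<Sum>i\<in>I. w i u)}) (mtopology_of X) h \<and>
     (\<forall>u\<in>topspace T. 0 < (\<Sum>i\<in>I. w i u) \<longrightarrow> (\<forall>z\<in>mspace X. \<forall>r\<le>\<rho>.
        (\<forall>i\<in>I. 0 < w i u \<longrightarrow> y i \<in> mball_of X z r) \<longrightarrow> h u \<in> mball_of X z r))"

lemma interpolates_in_mball:
  assumes "interpolates T I w y h" "u \<in> topspace T" "0 < (\<Sum>i\<in>I. w i u)" "z \<in> mspace X" "r \<le> \<rho>"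
    and "\<And>i. \<lbrakk>i \<in> I; 0 < w i u\<rbrakk> \<Longrightarrow> y i \<in> mball_of X z r"
  shows "h u \<in> mball_of X z r"
  using assms unfolding interpolates_def by blast

context
  fixes T :: "'b topology" and I :: "'i set" and w :: "'i \<Rightarrow> 'b \<Rightarrow> real" and y h and k
  assumes I: "finite I" "k \<notin> I" and w: "\<And>i. i \<in> insert k I \<Longrightarrow> continuous_map T euclideanreal (w i)"
    and w_nonneg: "\<And>i u. \<lbrakk>i \<in> insert k I; u \<in> topspace T\<rbrakk> \<Longrightarrow> 0 \<le> w i u"
    and y: "\<And>i. i \<in> insert k I \<Longrightarrow> y i \<in> mspace X" and h: "interpolates T I w y h"
begin

lemma interpolates_insert_continuous:
  assumes near: "\<And>i u. \<lbrakk>i \<in> I; u \<in> topspace T; 0 < w i u; 0 < w k u\<rbrakk> \<Longrightarrow> mdist X (y k) (y i) < \<rho>"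
  shows "continuous_map (subtopology T {u. 0 < (\<Sum>i\<in>insert k I. w i u)}) (mtopology_of X)
    (\<lambda>u. geodesic_point X (h u) (y k) (w k u / (\<Sum>i\<in>insert k I. w i u)))"
    (is "continuous_map ?T' _ _")
proof (rule continuous_map_geodesic_glue)
  let ?S = "\<lambda>u. \<Sum>i\<in>I. w i u"
  have [simp]: "(\<Sum>i\<in>insert k I. w i u) = w k u + ?S u" for u using I by simp
  have nonneg: "0 \<le> w k u" "0 \<le> ?S u" if "u \<in> topspace T" for u
    using w_nonneg that by (auto intro: sum_nonneg)
  have wk: "continuous_map ?T' euclideanreal (w k)" and S: "continuous_map ?T' euclideanreal ?S"
    using w I(1) by (auto intro!: continuous_map_from_subtopology continuous_map_sum)
  show "continuous_map ?T' euclideanreal (\<lambda>u. w k u / (\<Sum>i\<in>insert k I. w i u))"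
    using continuous_map_real_divide[OF wk continuous_map_add[OF wk S]] by simp
  have "continuous_map (subtopology T {u. 0 < ?S u}) (mtopology_of X) h"
    using h by (simp add: interpolates_def)
  then show "continuous_map (subtopology ?T' {u \<in> topspace ?T'. w k u / (\<Sum>i\<in>insert k I. w i u) \<noteq> 1})
      (mtopology_of X) h"
    unfolding subtopology_subtopology
    by (rule continuous_map_from_subtopology_mono) (use nonneg in \<open>auto simp: less_le\<close>)
  fix u assume u: "u \<in> topspace ?T'"
  show "w k u / (\<Sum>i\<in>insert k I. w i u) \<in> {0..1}"
    using nonneg[of u] u by (simp add: divide_le_eq_1)
  assume "w k u / (\<Sum>i\<in>insert k I. w i u) \<noteq> 0" "w k u / (\<Sum>i\<in>insert k I. w i u) \<noteq> 1"
  then have "0 < w k u" "0 < ?S u" using nonneg[of u] u by (auto simp: less_le)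
  then have "h u \<in> mball_of X (y k) \<rho>"
    using u y near by (intro interpolates_in_mball[OF h]) auto
  then show "mdist X (h u) (y k) < \<rho>" by (simp add: mdist_commute)
qed (use y in simp)

lemma interpolates_insert_in_mball:
  assumes u: "u \<in> topspace T" "0 < (\<Sum>i\<in>insert k I. w i u)" and z: "z \<in> mspace X" "r \<le> \<rho>"
    and ball: "\<And>i. \<lbrakk>i \<in> insert k I; 0 < w i u\<rbrakk> \<Longrightarrow> y i \<in> mball_of X z r"
  shows "geodesic_point X (h u) (y k) (w k u / (\<Sum>i\<in>insert k I. w i u)) \<in> mball_of X z r"
    (is "?p \<in> _")
proof -
  let ?S = "\<Sum>i\<in>I. w i u"
  have nonneg: "0 \<le> w k u" "0 \<le> ?S"
    using w_nonneg u(1) by (auto intro: sum_nonneg)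
  have hu: "h u \<in> mball_of X z r" if "0 < ?S"
    using that u(1) z ball by (intro interpolates_in_mball[OF h]) auto
  have "0 < w k u + ?S" using u(2) I by simp
  then consider (old) "w k u = 0" "0 < ?S" | (new) "?S = 0" "0 < w k u" | (both) "0 < ?S" "0 < w k u"
    using nonneg by linarith
  then show ?thesis
  proof cases
    case old
    then show ?thesis using hu by simp
  next
    case new
    then show ?thesis using ball[of k] I by simp
  next
    case both
    then have "?p \<in> metric_segment X (h u) (y k)"
      using y hu I
      by (intro geodesic_point_in_metric_segment complete_length) (auto simp: divide_le_eq_1)
    then show ?thesis using mball_metric_segment_subset[OF z(1) hu _ z(2)] ball both by blast
  qed
qed

end

lemma interpolates_exists:
  assumes "finite I" and "\<And>i. i \<in> I \<Longrightarrow> continuous_map T euclideanreal (w i)"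
    and "\<And>i u. \<lbrakk>i \<in> I; u \<in> topspace T\<rbrakk> \<Longrightarrow> 0 \<le> w i u"
    and "\<And>i. i \<in> I \<Longrightarrow> y i \<in> mspace X"
    and "\<And>i j u. \<lbrakk>i \<in> I; j \<in> I; u \<in> topspace T; 0 < w i u; 0 < w j u\<rbrakk> \<Longrightarrow> mdist X (y i) (y j) < \<rho>"
  shows "\<exists>h. interpolates T I w y h"
  using assms
proof (induction I rule: finite_induct)
  case empty
  show ?case by (intro exI[of _ "\<lambda>_. undefined"]) (simp add: interpolates_def continuous_map_def)
next
  case (insert k I)
  have "\<exists>h. interpolates T I w y h" by (rule insert.IH) (use insert.prems in auto)
  then obtain h where "interpolates T I w y h" by blast
  note step = interpolates_insert_continuous[OF insert.hyps _ _ _ this]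
    interpolates_insert_in_mball[OF insert.hyps _ _ _ this]
  show ?case
    unfolding interpolates_def
    by (intro exI[of _ "\<lambda>u. geodesic_point X (h u) (y k) (w k u / (\<Sum>i\<in>insert k I. w i u))"]
        conjI ballI impI allI step) (use insert.prems in auto)
qed

end

section \<open>Correspondences\<close>

definition correspondence :: "'a metric \<Rightarrow> 'b metric \<Rightarrow> real \<Rightarrow> ('a \<times> 'b) set \<Rightarrow> bool" where
  "correspondence X Y \<delta> R \<longleftrightarrow> Domain R = mspace X \<and> Range R = mspace Y \<and>
     (\<forall>(x, y)\<in>R. \<forall>(x', y')\<in>R. \<bar>mdist X x x' - mdist Y y y'\<bar> < \<delta>)"

lemma correspondence_converse: "correspondence X Y \<delta> R \<Longrightarrow> correspondence Y X \<delta> (R\<inverse>)"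
  by (fastforce simp: correspondence_def abs_minus_commute)

lemma correspondence_in_mspace:
  assumes "correspondence X Y \<delta> R" "(x, y) \<in> R"
  shows "x \<in> mspace X" "y \<in> mspace Y"
  using assms by (auto simp: correspondence_def)

lemma correspondence_mdist_less:
  assumes "correspondence X Y \<delta> R" "(x, y) \<in> R" "(x', y') \<in> R"
  shows "mdist Y y y' < mdist X x x' + \<delta>"
  using assms by (fastforce simp: correspondence_def)

lemma hausdorff_dist_correspondence:
  assumes f: "isometric_embedding X Z f" and g: "isometric_embedding Y Z g"
    and less: "hausdorff_dist Z (f ` mspace X) (g ` mspace Y) < ereal \<epsilon>"
  shows "correspondence X Y (2 * \<epsilon>)
    {(x, y). x \<in> mspace X \<and> y \<in> mspace Y \<and> mdist Z (f x) (g y) < \<epsilon>}" (is "correspondence _ _ _ ?R")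
  unfolding correspondence_def
proof (intro conjI)
  obtain r where "r < \<epsilon>" and XY: "f ` mspace X \<subseteq> (\<Union>b\<in>g ` mspace Y. mball_of Z b r)"
    and YX: "g ` mspace Y \<subseteq> (\<Union>a\<in>f ` mspace X. mball_of Z a r)"
    using less unfolding hausdorff_dist_def Inf_less_iff by auto
  have "\<exists>y\<in>mspace Y. mdist Z (f x) (g y) < \<epsilon>" if "x \<in> mspace X" for x
  proof -
    have "f x \<in> (\<Union>b\<in>g ` mspace Y. mball_of Z b r)" using XY that by blast
    then show ?thesis using \<open>r < \<epsilon>\<close> by (force simp: mdist_commute)
  qed
  then show "Domain ?R = mspace X" by auto
  have "\<exists>x\<in>mspace X. mdist Z (f x) (g y) < \<epsilon>" if "y \<in> mspace Y" for y
  proof -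
    have "g y \<in> (\<Union>a\<in>f ` mspace X. mball_of Z a r)" using YX that by blast
    then show ?thesis using \<open>r < \<epsilon>\<close> by force
  qed
  then show "Range ?R = mspace Y" by auto
  have "\<bar>mdist X x x' - mdist Y y y'\<bar> < 2 * \<epsilon>" if R: "(x, y) \<in> ?R" "(x', y') \<in> ?R" for x y x' y'
  proof -
    have in_space: "f x \<in> mspace Z" "f x' \<in> mspace Z" "g y \<in> mspace Z" "g y' \<in> mspace Z"
      and eq: "mdist Z (f x) (f x') = mdist X x x'" "mdist Z (g y) (g y') = mdist Y y y'"
      using f g R by (auto simp: isometric_embedding_def)
    have "mdist Z (f x) (f x') \<le> mdist Z (f x) (g y) + mdist Z (g y) (f x')"
      "mdist Z (g y) (f x') \<le> mdist Z (g y) (g y') + mdist Z (g y') (f x')"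
      "mdist Z (g y) (g y') \<le> mdist Z (g y) (f x) + mdist Z (f x) (g y')"
      "mdist Z (f x) (g y') \<le> mdist Z (f x) (f x') + mdist Z (f x') (g y')"
      using in_space by (auto intro: mdist_triangle)
    moreover have "mdist Z (f x) (g y) < \<epsilon>" "mdist Z (f x') (g y') < \<epsilon>" using R by auto
    ultimately show ?thesis
      using eq mdist_commute[of Z "f x" "g y"] mdist_commute[of Z "f x'" "g y'"] by linarith
  qed
  then show "\<forall>(x, y)\<in>?R. \<forall>(x', y')\<in>?R. \<bar>mdist X x x' - mdist Y y y'\<bar> < 2 * \<epsilon>" by blast
qed

lemma GH_dist_correspondence:
  assumes "GH_dist X Y < ereal \<epsilon>"
  obtains R where "correspondence X Y (2 * \<epsilon>) R"
  using assms hausdorff_dist_correspondence unfolding GH_dist_def Inf_less_iff by blast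

lemma (in compact_convexity_radius_ge) continuous_map_near_correspondence:
  assumes Z: "compact_space (mtopology_of Z)" and R: "correspondence Z X \<delta> R"
    and \<eta>: "0 < \<eta>" "\<delta> + 2 * \<eta> \<le> \<rho>"
  obtains f where "continuous_map (mtopology_of Z) (mtopology_of X) f"
    "\<And>z x. (z, x) \<in> R \<Longrightarrow> mdist X x (f z) < \<delta> + \<eta>"
proof -
  obtain K w where K: "finite K" "K \<subseteq> mspace Z"
    and w: "\<And>p. p \<in> K \<Longrightarrow> continuous_map (mtopology_of Z) euclideanreal (w p)" "\<And>p z. 0 \<le> w p z"
    and w_pos: "\<And>p z. 0 < w p z \<longleftrightarrow> mdist Z p z < \<eta>"
    and sum_pos: "\<And>z. z \<in> mspace Z \<Longrightarrow> 0 < (\<Sum>p\<in>K. w p z)"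
    using compact_space_bump_functions[OF Z \<eta>(1)] by blast
  have "\<forall>p\<in>K. \<exists>x. (p, x) \<in> R" using K(2) R by (auto simp: correspondence_def)
  then obtain y where y: "\<And>p. p \<in> K \<Longrightarrow> (p, y p) \<in> R" by metis
  have y_in: "y p \<in> mspace X" if "p \<in> K" for p using correspondence_in_mspace[OF R y[OF that]] by simp
  have "mdist X (y p) (y q) < \<rho>"
    if pq: "p \<in> K" "q \<in> K" and z: "z \<in> topspace (mtopology_of Z)" "0 < w p z" "0 < w q z" for p q z
  proof -
    have "mdist Z p q \<le> mdist Z p z + mdist Z q z"
      using mdist_triangle[of p Z z q] pq z K(2) by (auto simp: mdist_commute[of Z z q])
    also have "\<dots> < 2 * \<eta>" using z by (simp add: w_pos)
    finally show ?thesis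
      using correspondence_mdist_less[OF R y[OF pq(1)] y[OF pq(2)]] \<eta>(2) by linarith
  qed
  then have "\<exists>f. interpolates (mtopology_of Z) K w y f" by (intro interpolates_exists K(1) w y_in)
  then obtain f where f: "interpolates (mtopology_of Z) K w y f" by blast
  show thesis
  proof (rule that)
    have "subtopology (mtopology_of Z) {z. 0 < (\<Sum>p\<in>K. w p z)} = mtopology_of Z"
      using sum_pos by (intro subtopology_superset) auto
    with f show "continuous_map (mtopology_of Z) (mtopology_of X) f" by (simp add: interpolates_def)
    fix z x assume zx: "(z, x) \<in> R"
    note zx_in = correspondence_in_mspace[OF R zx]
    have "y p \<in> mball_of X x (\<delta> + \<eta>)" if p: "p \<in> K" "0 < w p z" for p
      using correspondence_mdist_less[OF R zx y[OF p(1)]] p zx_in y_in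
      by (simp add: w_pos mdist_commute)
    then have "f z \<in> mball_of X x (\<delta> + \<eta>)"
      using zx_in sum_pos \<eta> by (intro interpolates_in_mball[OF f]) auto
    then show "mdist X x (f z) < \<delta> + \<eta>" by simp
  qed
qed

lemma correspondence_composition_near_id:
  assumes R: "correspondence X Y \<delta> R"
    and f: "\<And>x y. (x, y) \<in> R \<Longrightarrow> mdist Y y (f x) < a" and g: "\<And>x y. (x, y) \<in> R \<Longrightarrow> mdist X x (g y) < b"
    and f_in: "f x \<in> mspace Y" and g_in: "g (f x) \<in> mspace X" and x: "x \<in> mspace X"
  shows "mdist X (g (f x)) x < a + b + \<delta>"
proof -
  have "x \<in> Domain R" "f x \<in> Range R" using R x f_in by (simp_all add: correspondence_def)
  then obtain x' y where y: "(x, y) \<in> R" and x': "(x', f x) \<in> R" by blast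
  have "mdist X x x' < mdist Y y (f x) + \<delta>"
    using correspondence_mdist_less[OF correspondence_converse[OF R]] y x' by simp
  also have "mdist Y y (f x) < a" by (rule f[OF y])
  finally show ?thesis
    using mdist_triangle[of x X x' "g (f x)"] g[OF x'] g_in x correspondence_in_mspace[OF R x']
    by (simp add: mdist_commute[of X "g (f x)"])
qed

lemma correspondence_imp_homotopy_equivalent:
  assumes X: "compact_convexity_radius_ge X \<rho>" and Y: "compact_convexity_radius_ge Y \<rho>"
    and \<delta>: "0 < \<delta>" "4 * \<delta> \<le> \<rho>" and R: "correspondence X Y \<delta> R"
  shows "mtopology_of X homotopy_equivalent_space mtopology_of Y"
proof -
  interpret X: compact_convexity_radius_ge X \<rho> by (fact X)
  interpret Y: compact_convexity_radius_ge Y \<rho> by (fact Y)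
  have \<eta>: "0 < \<delta> / 2" "\<delta> + 2 * (\<delta> / 2) \<le> \<rho>" using \<delta> by auto
  obtain f where f: "continuous_map (mtopology_of X) (mtopology_of Y) f"
    and f_near: "\<And>x y. (x, y) \<in> R \<Longrightarrow> mdist Y y (f x) < \<delta> + \<delta> / 2"
    using Y.continuous_map_near_correspondence[OF X.compact R \<eta>] by blast
  obtain g where g: "continuous_map (mtopology_of Y) (mtopology_of X) g"
    and g_near: "\<And>y x. (y, x) \<in> R\<inverse> \<Longrightarrow> mdist X x (g y) < \<delta> + \<delta> / 2"
    using X.continuous_map_near_correspondence[OF Y.compact correspondence_converse[OF R] \<eta>] by blast
  have f_in: "f x \<in> mspace Y" if "x \<in> mspace X" for x using f that by (auto simp: continuous_map_def)
  have g_in: "g y \<in> mspace X" if "y \<in> mspace Y" for y using g that by (auto simp: continuous_map_def)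
  have "mdist X (g (f x)) x < \<rho>" if x: "x \<in> mspace X" for x
    using correspondence_composition_near_id[OF R f_near g_near f_in g_in x] f_in g_in x \<delta> by force
  then have "homotopic_with (\<lambda>_. True) (mtopology_of X) (mtopology_of X) (g \<circ> f) id"
    using f g by (intro X.nearby_maps_homotopic continuous_map_compose) auto
  moreover have "mdist Y (f (g y)) y < \<rho>" if y: "y \<in> mspace Y" for y
    using correspondence_composition_near_id[OF correspondence_converse[OF R] g_near f_near g_in f_in y]
      f_in g_in y \<delta> by force
  then have "homotopic_with (\<lambda>_. True) (mtopology_of Y) (mtopology_of Y) (f \<circ> g) id"
    using f g by (intro Y.nearby_maps_homotopic continuous_map_compose) auto
  ultimately show ?thesis using f g unfolding homotopy_equivalent_space_def by blast
qed

section \<open>Finiteness of homotopy types\<close>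

lemma equiv_same_homotopy_type: "equiv UNIV same_homotopy_type"
proof (rule equivI)
  have iff: "(X, Y) \<in> same_homotopy_type \<longleftrightarrow> mtopology_of X homotopy_equivalent_space mtopology_of Y"
    for X Y :: "'a metric"
    by (simp add: same_homotopy_type_def)
  show "refl (same_homotopy_type :: ('a metric \<times> 'a metric) set)"
    by (simp add: refl_on_def iff homotopy_equivalent_space_refl)
  show "sym (same_homotopy_type :: ('a metric \<times> 'a metric) set)"
    by (metis symI iff homotopy_equivalent_space_sym)
  show "trans (same_homotopy_type :: ('a metric \<times> 'a metric) set)"
    by (metis transI iff homotopy_eqv_trans)
qed simp

lemma finite_homotopy_types:
  assumes K: "finite K" and meets: "\<And>X. X \<in> F \<Longrightarrow> \<exists>Y\<in>K. (Y, X) \<in> same_homotopy_type"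
  shows "finite (homotopy_types F)"
proof -
  have "homotopy_types F \<subseteq> (\<lambda>Y. same_homotopy_type `` {Y}) ` K"
  proof
    fix C assume "C \<in> homotopy_types F"
    then obtain X where X: "X \<in> F" and C: "C = same_homotopy_type `` {X}"
      unfolding homotopy_types_def by (rule quotientE)
    obtain Y where "Y \<in> K" "(Y, X) \<in> same_homotopy_type" using meets[OF X] by blast
    then show "C \<in> (\<lambda>Y. same_homotopy_type `` {Y}) ` K"
      using equiv_class_eq[OF equiv_same_homotopy_type] C by blast
  qed
  then show ?thesis using K by (rule finite_subset[OF _ finite_imageI])
qed

theorem corollary4:
  fixes \<kappa> \<rho>\<^sub>0 :: real and F :: "'a metric set"
  assumes "\<rho>\<^sub>0 > 0"
    and "\<And>X. X \<in> F \<Longrightarrow> compact_space (mtopology_of X)"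
    and "\<And>X. X \<in> F \<Longrightarrow> curvature_le \<kappa> X"
    and "\<And>X. X \<in> F \<Longrightarrow> convexity_radius X \<ge> ereal \<rho>\<^sub>0"
    and "GH_precompact F"
  shows "finite (homotopy_types F)"
proof -
  have convex: "compact_convexity_radius_ge X \<rho>\<^sub>0" if "X \<in> F" for X
    using assms(2-4)[OF that] by unfold_locales (auto simp: curvature_le_def)
  have "\<exists>K. finite K \<and> K \<subseteq> F \<and> (\<forall>X\<in>F. \<exists>Y\<in>K. GH_dist Y X < ereal (\<rho>\<^sub>0 / 8))"
    using assms(1,5) by (simp add: GH_precompact_def)
  then obtain K where K: "finite K" "K \<subseteq> F"
    and net: "\<And>X. X \<in> F \<Longrightarrow> \<exists>Y\<in>K. GH_dist Y X < ereal (\<rho>\<^sub>0 / 8)"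
    by metis
  have "\<exists>Y\<in>K. (Y, X) \<in> same_homotopy_type" if X: "X \<in> F" for X
  proof -
    obtain Y where Y: "Y \<in> K" "GH_dist Y X < ereal (\<rho>\<^sub>0 / 8)" using net[OF X] by blast
    then obtain R where "correspondence Y X (2 * (\<rho>\<^sub>0 / 8)) R" using GH_dist_correspondence by blast
    then have "mtopology_of Y homotopy_equivalent_space mtopology_of X"
      using assms(1) convex X Y(1) K(2) by (intro correspondence_imp_homotopy_equivalent) auto
    then show ?thesis using Y(1) by (auto simp: same_homotopy_type_def)
  qed
  with K(1) show ?thesis by (rule finite_homotopy_types)
qed

end
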